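(* Let $G$ be a connected graph such that $\mathrm{Aut}(G[P_2])=\mathrm{Aut}(G)[\mathrm{Aut}(P_2)]$. Then $$D'(G[P_2])\leq \min\Big\{k : \sum_{m=2}^{k}\Big(2\binom{m-1}{1}+m\binom{m-1}{2}+\binom{m-1}{3}\Big)\geq D'(G)\Big\}.$$
   Context: All graphs are finite and simple; $P_2$ is the path on two vertices. For a graph $X$, an edge labeling $\psi:E(X)\to\{1,\dots,d\}$ is distinguishing if the only automorphism of $X$ preserving all edge labels is the identity; the distinguishing index $D'(X)$ is the least $d$ such that $X$ has a distinguishing edge labeling with $d$ labels. The lexicographic product $G[H]$ has vertex set $V(G)\times V(H)$, with $(a,x)$ adjacent to $(b,y)$ iff $ab\in E(G)$, or $a=b$ and $xy\in E(H)$. The wreath product $\mathrm{Aut}(G)[\mathrm{Aut}(H)]$ is the subgroup of $\mathrm{Aut}(G[H])$ consisting of all maps $(g,h)\mapsto(\alpha g,\beta_g h)$ with $\alpha\in\mathrm{Aut}(G)$ and $\beta_g\in\mathrm{Aut}(H)$ for each $g\in V(G)$. *)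

theory Defs
  imports
    "HOL-Library.Extended_Nat"
    "HOL-Library.FuncSet"
    "HOL-Combinatorics.Permutations"
    "Graph_Theory.Graph_Theory"
begin

text \<open>
  A finite simple graph is a \<open>pair_graph\<close>: finitely many vertices and a symmetric, irreflexive
  set of arcs, so that an undirected edge is a pair of opposite arcs.
\<close>

definition edges :: "'a pair_pre_digraph \<Rightarrow> 'a set set" where
  "edges X = {{u, v} | u v. (u, v) \<in> parcs X}"

text \<open>
  Automorphisms are functions on the whole vertex type that are the identity outside the vertex
  set (this is part of \<open>permutes\<close>), so that equality of automorphisms is equality of functions.
\<close>

definition Aut :: "'a pair_pre_digraph \<Rightarrow> ('a \<Rightarrow> 'a) set" where
  "Aut X = {f. f permutes pverts X \<and>
     (\<forall>u\<in>pverts X. \<forall>v\<in>pverts X. (f u, f v) \<in> parcs X \<longleftrightarrow> (u, v) \<in> parcs X)}"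

definition distinguishing :: "'a pair_pre_digraph \<Rightarrow> ('a set \<Rightarrow> nat) \<Rightarrow> bool" where
  "distinguishing X \<psi> \<longleftrightarrow> (\<forall>f\<in>Aut X. (\<forall>e\<in>edges X. \<psi> (f ` e) = \<psi> e) \<longrightarrow> f = id)"

text \<open>
  The value is \<open>\<infinity>\<close> for graphs without any distinguishing edge labeling, such as the path on two
  vertices; a finite upper bound therefore includes the existence of such a labeling.
\<close>

definition distinguishing_index :: "'a pair_pre_digraph \<Rightarrow> enat" where
  "distinguishing_index X =
     (INF d \<in> {d. \<exists>\<psi> \<in> edges X \<rightarrow> {1..d}. distinguishing X \<psi>}. enat d)"

definition lex_product ::
  "'a pair_pre_digraph \<Rightarrow> 'b pair_pre_digraph \<Rightarrow> ('a \<times> 'b) pair_pre_digraph" where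
  "lex_product G H = \<lparr>
     pverts = pverts G \<times> pverts H,
     parcs = {((a, x), (b, y)) | a x b y.
        a \<in> pverts G \<and> b \<in> pverts G \<and> x \<in> pverts H \<and> y \<in> pverts H \<and>
        ((a, b) \<in> parcs G \<or> a = b \<and> (x, y) \<in> parcs H)}\<rparr>"

definition wreath ::
  "'a pair_pre_digraph \<Rightarrow> 'b pair_pre_digraph \<Rightarrow> ('a \<times> 'b \<Rightarrow> 'a \<times> 'b) set" where
  "wreath G H = {(\<lambda>(g, h). if g \<in> pverts G \<and> h \<in> pverts H then (\<alpha> g, \<beta> g h) else (g, h)) | \<alpha> \<beta>.
     \<alpha> \<in> Aut G \<and> (\<forall>g\<in>pverts G. \<beta> g \<in> Aut H)}"

definition P2 :: "bool pair_pre_digraph" where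
  "P2 = \<lparr>pverts = UNIV, parcs = {(False, True), (True, False)}\<rparr>"

end

theory Submission
  imports Defs
begin

text \<open>
  Choose a maximal independent set \<open>I\<close> and label the edge inside the fibre of \<open>u\<close> according to
  whether \<open>u \<in> I\<close>. An edge \<open>uv\<close> of \<open>G\<close> becomes four edges, that is, a two by two matrix of labels.
  A colour is coded by labels \<open>a, b, c, d\<close> with \<open>a - d > \<bar>b - c\<bar>\<close>; the number of such quadruples is
  at least the sum in the bound. If \<open>I\<close> separates the ends of \<open>uv\<close>, the matrix has rows
  \<open>(a, b)\<close> and \<open>(c, d)\<close>, the rows belonging to the end in \<open>I\<close>. As both row sums and column sums
  decrease, and every vertex lies on such an edge, the total of the labels on these edges tells the
  two copies of each vertex apart, so that only automorphisms of \<open>G\<close> acting identically on the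
  fibres survive. On the remaining edges no orientation is available, but there rows \<open>(b, a)\<close> and
  \<open>(d, c)\<close> work: since \<open>a > d\<close>, transposing the matrix does no harm.
  Hence a surviving automorphism preserves the given labeling of \<open>G\<close>.
\<close>

section \<open>Counting the codes\<close>

text \<open>Going from \<open>n\<close> to \<open>Suc n\<close> adds one row and one column, each
  contributing \<open>1 + ... + n\<close>.\<close>

lemma sum_abs_diff:
  "3 * (\<Sum>i = 1..n. \<Sum>j = 1..n. \<bar>int i - int j\<bar>) = int n ^ 3 - int n"
proof (induction n)
  case (Suc n)
  have row: "2 * (\<Sum>i = 1..n. \<bar>int (Suc n) - int i\<bar>) = int n * (int n + 1)"
  proof -
    \<comment> \<open>The limit \<open>m\<close> is kept apart from \<open>n\<close>, which also
      occurs in the summand and must stay fixed during the induction.\<close>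
    have "2 * (\<Sum>i = 1..m. int (Suc n) - int i) = int m * (2 * int n + 1 - int m)" for m
      by (induction m) (auto simp: algebra_simps)
    from this[of n] have "2 * (\<Sum>i = 1..n. int (Suc n) - int i) = int n * (int n + 1)"
      by simp
    moreover have "(\<Sum>i = 1..n. \<bar>int (Suc n) - int i\<bar>) = (\<Sum>i = 1..n. int (Suc n) - int i)"
      by (intro sum.cong) auto
    ultimately show ?thesis by simp
  qed
  have "(\<Sum>i = 1..Suc n. \<Sum>j = 1..Suc n. \<bar>int i - int j\<bar>) =
      (\<Sum>i = 1..n. \<Sum>j = 1..n. \<bar>int i - int j\<bar>) +
      (\<Sum>i = 1..n. \<bar>int i - int (Suc n)\<bar>) + (\<Sum>i = 1..n. \<bar>int (Suc n) - int i\<bar>)"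
    by (simp add: sum.distrib)
  also have "(\<Sum>i = 1..n. \<bar>int i - int (Suc n)\<bar>) = (\<Sum>i = 1..n. \<bar>int (Suc n) - int i\<bar>)"
    by (intro sum.cong) auto
  finally show ?case
    using Suc row by (simp add: algebra_simps power3_eq_cube)
qed auto

text \<open>
  The truncated subtractions add up to \<open>a - \<bar>b - c\<bar>\<close>, so the last component ranges over all \<open>d \<ge> 1\<close>
  with \<open>a - d > \<bar>b - c\<bar>\<close>.
\<close>
definition codes :: "nat \<Rightarrow> (nat \<times> nat \<times> nat \<times> nat) set" where
  "codes k = (SIGMA a:{2..k}. SIGMA b:{1..a}. SIGMA c:{1..a}. {1..<a - (b - c) - (c - b)})"

lemma codesD:
  assumes "(a, b, c, d) \<in> codes k"
  shows "{a, b, c, d} \<subseteq> {1..k}" "c + d < a + b" "b + d < a + c" "d < a"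
  using assms unfolding codes_def by auto

lemma int_choose_two: "2 * int (n choose 2) = int n * (int n - 1)"
  by (induction n) (auto simp: numeral_2_eq_2 algebra_simps)

lemma int_choose_three: "6 * int (n choose 3) = int n * (int n - 1) * (int n - 2)"
proof (induction n)
  case (Suc n)
  have "Suc n choose 3 = (n choose 2) + (n choose 3)"
    by (simp add: numeral_3_eq_3 numeral_2_eq_2)
  then show ?case
    using Suc int_choose_two[of n] by (simp add: algebra_simps)
qed auto

text \<open>The right-hand side counts the codes with first component \<open>m\<close>; its closed
  form is \<open>m * (m - 1) * (2 * m - 1) / 3\<close>.\<close>

lemma slice_bound:
  assumes "2 \<le> m"
  shows "2 * ((m - 1) choose 1) + m * ((m - 1) choose 2) + ((m - 1) choose 3)
    \<le> (\<Sum>b = 1..m. \<Sum>c = 1..m. m - (b - c) - (c - b) - 1)"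
proof -
  obtain n where m: "m = n + 2"
    using assms by (metis add.commute le_Suc_ex)
  define S where "S = (\<Sum>b = 1..m. \<Sum>c = 1..m. m - (b - c) - (c - b) - 1)"
  \<comment> \<open>As \<open>\<bar>b - c\<bar> \<le> m - 1\<close>, the successive subtractions
    from \<open>m\<close> never truncate.\<close>
  have "int S = (\<Sum>b = 1..m. \<Sum>c = 1..m. (int m - 1) - \<bar>int b - int c\<bar>)"
    unfolding S_def of_nat_sum by (intro sum.cong refl) auto
  also have "\<dots> = int m ^ 2 * (int m - 1) - (\<Sum>b = 1..m. \<Sum>c = 1..m. \<bar>int b - int c\<bar>)"
    by (simp add: sum_subtractf power2_eq_square)
  finally have "3 * int S = 3 * (int m ^ 2 * (int m - 1)) - (int m ^ 3 - int m)"
    using sum_abs_diff[of m] by simp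
  then have S: "6 * int S = 2 * (int n + 2) * (int n + 1) * (2 * int n + 3)"
    by (simp add: m algebra_simps power2_eq_square power3_eq_cube)
  have "6 * (int m * int ((n + 1) choose 2)) = 3 * int m * (2 * int ((n + 1) choose 2))"
    by simp
  also have "\<dots> = 3 * (int n + 2) * (int n + 1) * int n"
    unfolding int_choose_two by (simp add: m algebra_simps)
  finally have "6 * (int m * int ((n + 1) choose 2)) = 3 * (int n + 2) * (int n + 1) * int n" .
  moreover have "6 * int ((n + 1) choose 3) = (int n + 1) * int n * (int n - 1)"
    using int_choose_three[of "n + 1"] by simp
  ultimately have "6 * int (2 * ((m - 1) choose 1) + m * ((m - 1) choose 2) + ((m - 1) choose 3))
      = 12 * (int n + 1) + 3 * (int n + 2) * (int n + 1) * int n + (int n + 1) * int n * (int n - 1)"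
    by (simp add: m algebra_simps)
  \<comment> \<open>The two sides differ by \<open>9 * n * (n + 1)\<close>.\<close>
  also have "\<dots> \<le> 6 * int S"
    unfolding S by (simp add: algebra_simps)
  finally show ?thesis
    unfolding S_def by (simp only: mult_le_cancel_left_pos zero_less_numeral of_nat_le_iff)
qed

lemma card_codes:
  "(\<Sum>m = 2..k. 2 * ((m - 1) choose 1) + m * ((m - 1) choose 2) + ((m - 1) choose 3))
    \<le> card (codes k)"
proof -
  have "card (codes k) = (\<Sum>m = 2..k. \<Sum>b = 1..m. \<Sum>c = 1..m. m - (b - c) - (c - b) - 1)"
    unfolding codes_def by simp
  then show ?thesis
    using slice_bound by (metis (no_types, lifting) atLeastAtMost_iff sum_mono)
qed

lemma ex_code:
  assumes "N \<le> card (codes k)"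
  obtains A B C D :: "nat \<Rightarrow> nat" where
    "\<And>x. x \<in> {1..N} \<Longrightarrow> (A x, B x, C x, D x) \<in> codes k"
    "\<And>x y. \<lbrakk>x \<in> {1..N}; y \<in> {1..N}; A x = A y; B x = B y; C x = C y; D x = D y\<rbrakk> \<Longrightarrow> x = y"
proof -
  have "finite (codes k)"
    unfolding codes_def by (intro finite_SigmaI) auto
  then obtain f where f: "f ` {1..N} \<subseteq> codes k" "inj_on f {1..N}"
    using card_le_inj[of "{1..N}" "codes k"] assms by auto
  have "\<exists>a b c d. f x = (a, b, c, d)" for x
    by (cases "f x") auto
  then obtain A B C D where ABCD: "\<And>x. f x = (A x, B x, C x, D x)"
    by metis
  show ?thesis
  proof (rule that)
    show "(A x, B x, C x, D x) \<in> codes k" if "x \<in> {1..N}" for x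
      using f(1) that unfolding ABCD[symmetric] by blast
    show "x = y" if "x \<in> {1..N}" "y \<in> {1..N}" "A x = A y" "B x = B y" "C x = C y" "D x = D y"
      for x y
      using that by (intro inj_onD[OF f(2)]) (simp_all add: ABCD)
  qed
qed

section \<open>Symmetric labels, neighbours and cuts\<close>

text \<open>Labels are chosen below on ordered pairs; symmetry lets them descend to edges, which are
  sets.\<close>

lemma ex_set_function:
  assumes "\<And>p q. F p q = F q p"
  shows "\<exists>L. \<forall>p q. L {p, q} = F p q"
proof -
  define L where "L e = (SOME x. \<exists>p q. e = {p, q} \<and> x = F p q)" for e
  have "L {p, q} = F p q" for p q
  proof -
    have "\<exists>p' q'. {p, q} = {p', q'} \<and> L {p, q} = F p' q'"
      unfolding L_def by (rule someI_ex) blast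
    then show ?thesis
      using assms by (metis doubleton_eq_iff)
  qed
  then show ?thesis by blast
qed

lemma (in pair_graph) arc_sym: "(u, v) \<in> parcs G \<Longrightarrow> (v, u) \<in> parcs G"
  using pair_sym_arcs by (auto simp: symmetric_def sym_def)

lemma (in pair_graph) arc_irrefl: "(u, v) \<in> parcs G \<Longrightarrow> u \<noteq> v"
  using pair_no_loops by fastforce

lemma (in pair_graph) connected_ex_neighbour:
  assumes "connected (with_proj G)" "2 \<le> card (pverts G)" "u \<in> pverts G"
  obtains v where "(u, v) \<in> parcs G"
proof -
  obtain w where w: "w \<in> pverts G" "w \<noteq> u"
    using assms(2,3) by (metis card_le_Suc0_iff_eq not_less_eq_eq numeral_2_eq_2 pair_finite_verts)
  have "strongly_connected (with_proj G)"
    using assms(1) pair_sym_arcs symmetric_connected_imp_strongly_connected by blast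
  then have "u \<rightarrow>\<^sup>*\<^bsub>with_proj G\<^esub> w"
    using assms(3) w(1) by (auto simp: strongly_connected_def)
  then have "(u, w) \<in> (parcs G)\<^sup>*"
    using reachable_rtranclI by fastforce
  then show ?thesis
    using w(2) that by (metis converse_rtranclE)
qed

text \<open>For a maximal independent \<open>I\<close>, members have all their neighbours outside,
  and a vertex outside with no neighbour in \<open>I\<close> could be added to it.\<close>

lemma (in pair_graph) ex_dominating_cut:
  assumes "\<And>u. u \<in> pverts G \<Longrightarrow> \<exists>v. (u, v) \<in> parcs G"
  obtains I where "\<And>u. u \<in> pverts G \<Longrightarrow> \<exists>v. (u, v) \<in> parcs G \<and> (u \<in> I) \<noteq> (v \<in> I)"
proof -
  define indep where "indep = {I. I \<subseteq> pverts G \<and> (\<forall>u\<in>I. \<forall>v\<in>I. (u, v) \<notin> parcs G)}"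
  have "finite indep" "{} \<in> indep"
    using pair_finite_verts by (auto simp: indep_def)
  then obtain I where I: "I \<in> indep" and max: "\<And>J. J \<in> indep \<Longrightarrow> I \<subseteq> J \<Longrightarrow> J = I"
    using finite_has_maximal[of indep] by (metis empty_iff)
  have "\<exists>v. (u, v) \<in> parcs G \<and> (u \<in> I) \<noteq> (v \<in> I)" if u: "u \<in> pverts G" for u
  proof (cases "u \<in> I")
    case True
    then show ?thesis using assms[OF u] I by (auto simp: indep_def)
  next
    case False
    show ?thesis
    proof (rule ccontr)
      assume none: "\<not> ?thesis"
      then have "(u, w) \<notin> parcs G" "(w, u) \<notin> parcs G" if "w \<in> I" for w
        using False that arc_sym by blast+
      moreover have "(u, u) \<notin> parcs G" using arc_irrefl by blast
      ultimately have "insert u I \<in> indep"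
        using I u by (auto simp: indep_def)
      then show False using max False by blast
    qed
  qed
  then show ?thesis by (rule that)
qed

section \<open>The labeling of the product\<close>

lemma (in pair_graph) arc_lex_product_P2_iff:
  "((u, i), (v, j)) \<in> parcs (lex_product G P2) \<longleftrightarrow>
    (u, v) \<in> parcs G \<or> u = v \<and> u \<in> pverts G \<and> i \<noteq> j"
  by (auto simp: lex_product_def P2_def dest: in_arcsD1 in_arcsD2)

lemma edgesI: "(u, v) \<in> parcs X \<Longrightarrow> {u, v} \<in> edges X"
  unfolding edges_def by blast

lemma (in pair_graph) ex_distinguishing_lex_product_P2:
  assumes nbr: "\<And>u. u \<in> pverts G \<Longrightarrow> \<exists>v. (u, v) \<in> parcs G"
    and wr: "Aut (lex_product G P2) \<subseteq> wreath G P2"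
    and \<psi>: "\<psi> \<in> edges G \<rightarrow> {1..N}" "distinguishing G \<psi>"
    and N: "N \<le> card (codes k)"
    and k: "2 \<le> k"
  shows "\<exists>L \<in> edges (lex_product G P2) \<rightarrow> {1..k}. distinguishing (lex_product G P2) L"
proof -
  obtain I where cut: "\<And>u. u \<in> pverts G \<Longrightarrow> \<exists>v. (u, v) \<in> parcs G \<and> (u \<in> I) \<noteq> (v \<in> I)"
    using ex_dominating_cut nbr by metis
  obtain A B C D where code: "\<And>x. x \<in> {1..N} \<Longrightarrow> (A x, B x, C x, D x) \<in> codes k"
    and code_inj: "\<And>x y. \<lbrakk>x \<in> {1..N}; y \<in> {1..N}; A x = A y; B x = B y; C x = C y; D x = D y\<rbrakk>
        \<Longrightarrow> x = y"
    using ex_code[OF N] by blast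
  \<comment> \<open>An arbitrary linear order orients the edges not separated by \<open>I\<close>;
    automorphisms may reverse this orientation.\<close>
  obtain num :: "'a \<Rightarrow> nat" where num: "inj_on num (pverts G)"
    using finite_imp_inj_to_nat_seg[OF pair_finite_verts] by blast
  define mixed where "mixed x i j = (if i then if j then D x else C x else if j then B x else A x)"
    for x i j
  \<comment> \<open>\<open>A\<close> and \<open>D\<close> stand off the diagonal: transposing
    exchanges them and fixes \<open>B\<close> and \<open>C\<close>.\<close>
  define pure where "pure x i j = (if i then if j then C x else D x else if j then A x else B x)"
    for x i j
  define F where "F p q = (case (p, q) of ((u, i), (v, j)) \<Rightarrow>
      if u = v then (if u \<in> I then 1 else 2)
      else if u \<in> I \<and> v \<notin> I then mixed (\<psi> {u, v}) i j
      else if u \<notin> I \<and> v \<in> I then mixed (\<psi> {u, v}) j i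
      else if num u < num v then pure (\<psi> {u, v}) i j
      else if num u > num v then pure (\<psi> {u, v}) j i
      else 1)" for p q \<comment> \<open>the last case is junk: \<open>num\<close> is injective on the vertices\<close>
  have F_sym: "F p q = F q p" for p q
    by (cases p; cases q) (auto simp: F_def insert_commute)
  then obtain L where L: "\<And>p q. L {p, q} = F p q"
    using ex_set_function[of F] by blast
  have \<psi>_in: "\<psi> {u, v} \<in> {1..N}" if "(u, v) \<in> parcs G" for u v
    using \<psi>(1) edgesI[OF that] by auto
  have "L e \<in> {1..k}" if e: "e \<in> edges (lex_product G P2)" for e
  proof -
    obtain u i v j where e: "e = {(u, i), (v, j)}"
        and arc: "((u, i), (v, j)) \<in> parcs (lex_product G P2)"
      using e by (auto simp: edges_def)
    have "F (u, i) (v, j) \<in> {1..k}"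
    proof (cases "(u, v) \<in> parcs G")
      case True
      from codesD(1)[OF code[OF \<psi>_in[OF this]]] show ?thesis
        using k by (auto simp: F_def mixed_def pure_def)
    next
      case False
      then show ?thesis using arc k by (auto simp: arc_lex_product_P2_iff F_def)
    qed
    then show ?thesis by (simp add: e L)
  qed
  moreover have "distinguishing (lex_product G P2) L"
    unfolding distinguishing_def
  proof (intro ballI impI)
    fix f assume f: "f \<in> Aut (lex_product G P2)"
      and pres: "\<forall>e\<in>edges (lex_product G P2). L (f ` e) = L e"
    obtain \<alpha> \<beta> where f_eq: "f = (\<lambda>(g, h). if g \<in> pverts G \<and> h \<in> pverts P2 then (\<alpha> g, \<beta> g h) else (g, h))"
      and \<alpha>: "\<alpha> \<in> Aut G" and \<beta>: "\<And>g. g \<in> pverts G \<Longrightarrow> \<beta> g \<in> Aut P2"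
      using f wr unfolding wreath_def by blast
    have f_app: "f (u, i) = (\<alpha> u, \<beta> u i)" if "u \<in> pverts G" for u i
      using that by (simp add: f_eq P2_def)
    have \<alpha>_perm: "\<alpha> permutes pverts G"
      and \<alpha>_arc: "\<And>u v. u \<in> pverts G \<Longrightarrow> v \<in> pverts G \<Longrightarrow>
            (\<alpha> u, \<alpha> v) \<in> parcs G \<longleftrightarrow> (u, v) \<in> parcs G"
      using \<alpha> by (auto simp: Aut_def)
    have \<alpha>_in: "\<alpha> u \<in> pverts G \<longleftrightarrow> u \<in> pverts G" for u
      using permutes_in_image[OF \<alpha>_perm] .
    have \<beta>_bij: "bij (\<beta> u)" if "u \<in> pverts G" for u
      using \<beta>[OF that] by (auto simp: Aut_def P2_def dest: permutes_bij)
    have F_pres: "F (\<alpha> u, \<beta> u i) (\<alpha> v, \<beta> v j) = F (u, i) (v, j)"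
      if "((u, i), (v, j)) \<in> parcs (lex_product G P2)" for u i v j
    proof -
      have "u \<in> pverts G" "v \<in> pverts G"
        using that by (auto simp: arc_lex_product_P2_iff dest: in_arcsD1 in_arcsD2)
      then show ?thesis
        using pres[rule_format, OF edgesI[OF that]] by (simp add: f_app L)
    qed
    \<comment> \<open>The edge inside a fibre goes to the edge inside the image fibre, and its label
      records membership in \<open>I\<close>.\<close>
    have I_pres: "\<alpha> u \<in> I \<longleftrightarrow> u \<in> I" if "u \<in> pverts G" for u
      using F_pres[of u False u True] that by (auto simp: arc_lex_product_P2_iff F_def split: if_splits)
    \<comment> \<open>\<open>W u i\<close> totals the labels from the copy \<open>(u, i)\<close> to
      the fibres across the cut.\<close>
    define M where "M u = {v. (u, v) \<in> parcs G \<and> (u \<in> I) \<noteq> (v \<in> I)}" for u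
    define W where "W u i = (\<Sum>v\<in>M u. \<Sum>j\<in>UNIV. F (u, i) (v, j))" for u i
    have M_sub: "M u \<subseteq> pverts G" for u
      by (auto simp: M_def dest: in_arcsD2)
    have M_fin: "finite (M u)" for u
      using M_sub pair_finite_verts finite_subset by blast
    have M_image: "M (\<alpha> u) = \<alpha> ` M u" if u: "u \<in> pverts G" for u
    proof (intro set_eqI iffI)
      fix w assume w: "w \<in> M (\<alpha> u)"
      then obtain v where v: "w = \<alpha> v" "v \<in> pverts G"
        using M_sub permutes_image[OF \<alpha>_perm] by blast
      then show "w \<in> \<alpha> ` M u"
        using w u by (auto simp: M_def \<alpha>_arc I_pres)
    next
      fix w assume "w \<in> \<alpha> ` M u"
      then obtain v where "w = \<alpha> v" "v \<in> M u" "v \<in> pverts G"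
        using M_sub by blast
      then show "w \<in> M (\<alpha> u)"
        using u by (auto simp: M_def \<alpha>_arc I_pres)
    qed
    have W_pres: "W (\<alpha> u) (\<beta> u i) = W u i" if u: "u \<in> pverts G" for u i
    proof -
      have "W (\<alpha> u) (\<beta> u i) = (\<Sum>v\<in>M u. \<Sum>j\<in>UNIV. F (\<alpha> u, \<beta> u i) (\<alpha> v, j))"
        unfolding W_def M_image[OF u]
        using permutes_inj_on[OF \<alpha>_perm] by (subst sum.reindex) (auto simp: o_def)
      also have "\<dots> = W u i"
        unfolding W_def
      proof (rule sum.cong[OF refl])
        fix v assume v: "v \<in> M u"
        \<comment> \<open>Summing over both copies of \<open>v\<close> makes the total independent
          of whether \<open>\<beta> v\<close> swaps them.\<close>
        have "(\<Sum>j\<in>UNIV. F (\<alpha> u, \<beta> u i) (\<alpha> v, j)) = (\<Sum>j\<in>UNIV. F (\<alpha> u, \<beta> u i) (\<alpha> v, \<beta> v j))"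
          using \<beta>_bij v M_sub by (intro sum.reindex_bij_betw[symmetric]) auto
        also have "\<dots> = (\<Sum>j\<in>UNIV. F (u, i) (v, j))"
          using v by (intro sum.cong refl F_pres) (auto simp: arc_lex_product_P2_iff M_def)
        finally show "(\<Sum>j\<in>UNIV. F (\<alpha> u, \<beta> u i) (\<alpha> v, j)) = (\<Sum>j\<in>UNIV. F (u, i) (v, j))" .
      qed
      finally show ?thesis .
    qed
    have W_less: "W u True < W u False" if u: "u \<in> pverts G" for u
      unfolding W_def
    proof (rule sum_strict_mono[OF M_fin])
      show "M u \<noteq> {}" using cut[OF u] by (auto simp: M_def)
      fix v assume v: "v \<in> M u"
      then have arc: "(u, v) \<in> parcs G" by (simp add: M_def)
      \<comment> \<open>For \<open>u \<in> I\<close> this compares the row sums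
        \<open>C + D < A + B\<close>, otherwise the column sums
        \<open>B + D < A + C\<close>.\<close>
      show "(\<Sum>j\<in>UNIV. F (u, True) (v, j)) < (\<Sum>j\<in>UNIV. F (u, False) (v, j))"
        using v codesD[OF code[OF \<psi>_in[OF arc]]] arc_irrefl[OF arc]
        by (auto simp: UNIV_bool F_def mixed_def M_def)
    qed
    have \<beta>_id: "\<beta> u i = i" if u: "u \<in> pverts G" for u i
    proof -
      \<comment> \<open>If \<open>\<beta> u\<close> swapped the copies, \<open>W_pres\<close> would
        turn \<open>W_less\<close> at \<open>u\<close> into the reverse inequality at
        \<open>\<alpha> u\<close>.\<close>
      have "\<beta> u False = False"
        using W_pres[OF u, of False] W_pres[OF u, of True] W_less[OF u] W_less[of "\<alpha> u"] u
        by (cases "\<beta> u False"; cases "\<beta> u True") (auto simp: \<alpha>_in)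
      moreover from this have "\<beta> u True = True"
        using \<beta>_bij[OF u] by (auto simp: bij_def inj_def)
      ultimately show ?thesis by (cases i) auto
    qed
    have \<psi>_pres: "\<psi> {\<alpha> u, \<alpha> v} = \<psi> {u, v}" if arc: "(u, v) \<in> parcs G" for u v
    proof -
      have uv: "u \<in> pverts G" "v \<in> pverts G" "u \<noteq> v"
        using arc in_arcsD1 in_arcsD2 arc_irrefl by auto
      have arc': "(\<alpha> u, \<alpha> v) \<in> parcs G" using arc uv \<alpha>_arc by simp
      have uv': "\<alpha> u \<in> pverts G" "\<alpha> v \<in> pverts G" "\<alpha> u \<noteq> \<alpha> v"
        using arc' in_arcsD1 in_arcsD2 arc_irrefl by auto
      have F_eq: "F (\<alpha> u, i) (\<alpha> v, j) = F (u, i) (v, j)" for i j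
        using F_pres[of u i v j] arc uv by (simp add: \<beta>_id arc_lex_product_P2_iff)
      let ?x = "\<psi> {u, v}" and ?y = "\<psi> {\<alpha> u, \<alpha> v}"
      have less: "D ?x < A ?x" "D ?y < A ?y"
        using codesD(4) code \<psi>_in arc arc' by blast+
      have neq: "num u \<noteq> num v" "num (\<alpha> u) \<noteq> num (\<alpha> v)"
        using num uv uv' by (auto simp: inj_on_def)
      \<comment> \<open>On separated edges \<open>I_pres\<close> fixes the orientation. On the
        others, a reversal would give \<open>A ?y = D ?x\<close> and \<open>D ?y = A ?x\<close>,
        contradicting \<open>less\<close>.\<close>
      have "A ?y = A ?x \<and> B ?y = B ?x \<and> C ?y = C ?x \<and> D ?y = D ?x"
        using F_eq[of False False] F_eq[of False True] F_eq[of True False] F_eq[of True True]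
          less neq uv(3) uv'(3)
        by (auto simp: F_def mixed_def pure_def I_pres uv(1,2) split: if_splits)
      then show ?thesis
        using code_inj \<psi>_in arc arc' by blast
    qed
    have "\<forall>e\<in>edges G. \<psi> (\<alpha> ` e) = \<psi> e"
      by (auto simp: edges_def \<psi>_pres)
    then have "\<alpha> = id"
      using \<psi>(2) \<alpha> by (simp add: distinguishing_def)
    then show "f = id"
      by (auto simp: f_eq \<beta>_id)
  qed
  ultimately show ?thesis by blast
qed

section \<open>Finiteness of the distinguishing index of the factor\<close>

text \<open>
  If \<open>uv\<close> were a component of \<open>G\<close>, exchanging one copy of \<open>u\<close> with one of \<open>v\<close> would be an
  automorphism that does not respect the fibres.
\<close>
lemma (in pair_graph) not_isolated_edge:
  assumes arc: "(u, v) \<in> parcs G"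
    and u: "\<And>w. (u, w) \<in> parcs G \<Longrightarrow> w = v"
    and v: "\<And>w. (v, w) \<in> parcs G \<Longrightarrow> w = u"
    and wr: "Aut (lex_product G P2) \<subseteq> wreath G P2"
  shows False
proof -
  define f where "f = transpose (u, False) (v, False)"
  have uv: "u \<in> pverts G" "v \<in> pverts G" "u \<noteq> v" "(v, u) \<in> parcs G"
    using arc in_arcsD1 in_arcsD2 arc_irrefl arc_sym by auto
  have arcs_u: "(u, w) \<in> parcs G \<longleftrightarrow> w = v" "(w, u) \<in> parcs G \<longleftrightarrow> w = v" for w
    using arc u arc_sym by blast+
  have arcs_v: "(v, w) \<in> parcs G \<longleftrightarrow> w = u" "(w, v) \<in> parcs G \<longleftrightarrow> w = u" for w
    using uv v arc_sym by blast+
  \<comment> \<open>The fibres over \<open>u\<close> and \<open>v\<close> form a complete component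
    on four vertices, so every permutation of it is an automorphism.\<close>
  have "f \<in> Aut (lex_product G P2)"
    unfolding Aut_def
  proof (intro CollectI conjI ballI)
    show "f permutes pverts (lex_product G P2)"
      unfolding f_def using uv by (intro permutes_swap_id) (auto simp: lex_product_def P2_def)
    fix p q :: "'a \<times> bool"
    obtain a i b j where "p = (a, i)" "q = (b, j)" by (cases p; cases q)
    then show "(f p, f q) \<in> parcs (lex_product G P2) \<longleftrightarrow> (p, q) \<in> parcs (lex_product G P2)"
      using uv by (auto simp: f_def transpose_def arc_lex_product_P2_iff arcs_u arcs_v)
  qed
  then obtain \<alpha> \<beta> where
    f_eq: "f = (\<lambda>(g, h). if g \<in> pverts G \<and> h \<in> pverts P2 then (\<alpha> g, \<beta> g h) else (g, h))"
    using wr unfolding wreath_def by blast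
  have "f (u, False) = (\<alpha> u, \<beta> u False)" "f (u, True) = (\<alpha> u, \<beta> u True)"
    using uv by (simp_all add: f_eq P2_def)
  then show False using uv by (simp add: f_def transpose_def)
qed

text \<open>Every edge is fixed as a set, so a moved vertex is swapped with each of its neighbours.
  It thus has just one, which is moved too, and the two form an isolated edge.\<close>

lemma (in pair_graph) distinguishing_inj_on:
  assumes nbr: "\<And>u. u \<in> pverts G \<Longrightarrow> \<exists>v. (u, v) \<in> parcs G"
    and wr: "Aut (lex_product G P2) \<subseteq> wreath G P2"
    and \<psi>: "inj_on \<psi> (edges G)"
  shows "distinguishing G \<psi>"
  unfolding distinguishing_def
proof (intro ballI impI)
  fix f assume f: "f \<in> Aut G" and pres: "\<forall>e\<in>edges G. \<psi> (f ` e) = \<psi> e"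
  have perm: "f permutes pverts G"
    and f_arc: "\<And>u v. (u, v) \<in> parcs G \<Longrightarrow> (f u, f v) \<in> parcs G"
    using f by (auto simp: Aut_def dest: in_arcsD1 in_arcsD2)
  have fix_edge: "{f u, f v} = {u, v}" if "(u, v) \<in> parcs G" for u v
    using \<psi> pres[rule_format, OF edgesI[OF that]] edgesI[OF that] edgesI[OF f_arc[OF that]]
    by (auto dest: inj_onD)
  have "f u = u" for u
  proof (rule ccontr)
    assume moved: "f u \<noteq> u"
    then have "u \<in> pverts G" using perm by (auto simp: permutes_def)
    then obtain v where v: "(u, v) \<in> parcs G" using nbr by blast
    have "f u = w" if "(u, w) \<in> parcs G" for w
      using fix_edge[OF that] moved by (auto simp: doubleton_eq_iff)
    moreover have "f v \<noteq> v" "f v = u"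
      using fix_edge[OF v] moved by (auto simp: doubleton_eq_iff)
    then have "f v = w" if "(v, w) \<in> parcs G" for w
      using fix_edge[OF that] by (auto simp: doubleton_eq_iff)
    ultimately show False
      using not_isolated_edge[OF v _ _ wr] v \<open>f v = u\<close> by metis
  qed
  then show "f = id" by auto
qed

section \<open>The bound on the index\<close>

lemma distinguishing_index_le:
  assumes "\<psi> \<in> edges X \<rightarrow> {1..d}" "distinguishing X \<psi>"
  shows "distinguishing_index X \<le> enat d"
  unfolding distinguishing_index_def using assms by (intro INF_lower) auto

text \<open>An infimum below \<open>Suc d\<close> has a witness \<open>d' \<le> d\<close>, and a
  labeling with \<open>d'\<close> labels is also one with \<open>d\<close>.\<close>

lemma distinguishing_index_leD:
  assumes "distinguishing_index X \<le> enat d"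
  obtains \<psi> where "\<psi> \<in> edges X \<rightarrow> {1..d}" "distinguishing X \<psi>"
proof -
  define S where "S = {d. \<exists>\<psi> \<in> edges X \<rightarrow> {1..d}. distinguishing X \<psi>}"
  have "(INF d\<in>S. enat d) < enat (Suc d)"
    using assms by (simp add: distinguishing_index_def S_def less_le_trans
        order.strict_trans1)
  then obtain d' where "d' \<in> S" "d' \<le> d"
    by (auto simp: INF_less_iff)
  then obtain \<psi> where "\<psi> \<in> edges X \<rightarrow> {1..d'}" "distinguishing X \<psi>"
    by (auto simp: S_def)
  then show ?thesis using \<open>d' \<le> d\<close> by (intro that[of \<psi>]) fastforce+
qed

theorem theorem3p5:
  fixes G :: "'a pair_pre_digraph"
  assumes "pair_graph G"
    and "connected (with_proj G)"
    and "2 \<le> card (pverts G)"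
    and "Aut (lex_product G P2) = wreath G P2"
  shows "distinguishing_index (lex_product G P2) \<le>
    enat (LEAST k. distinguishing_index G \<le>
      enat (\<Sum>m = 2..k. 2 * ((m - 1) choose 1) + m * ((m - 1) choose 2) + ((m - 1) choose 3)))"
proof -
  interpret pair_graph G by fact
  define N where "N k = (\<Sum>m = 2..k. 2 * ((m - 1) choose 1) + m * ((m - 1) choose 2) + ((m - 1) choose 3))"
    for k :: nat
  define k where "k = (LEAST k. distinguishing_index G \<le> enat (N k))"
  have nbr: "\<And>u. u \<in> pverts G \<Longrightarrow> \<exists>v. (u, v) \<in> parcs G"
    using connected_ex_neighbour assms(2,3) by metis
  have wr: "Aut (lex_product G P2) \<subseteq> wreath G P2" using assms(4) by simp
  have "edges G \<subseteq> Pow (pverts G)"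
    by (auto simp: edges_def dest: in_arcsD1 in_arcsD2)
  then have "finite (edges G)"
    using pair_finite_verts by (auto intro: finite_subset)
  then obtain \<psi> where \<psi>: "bij_betw \<psi> (edges G) {1..card (edges G)}"
    by (metis finite_same_card_bij finite_atLeastAtMost card_atLeastAtMost diff_Suc_1)
  \<comment> \<open>\<open>N\<close> is unbounded, so together with the finite index the set behind
    \<open>LEAST\<close> is nonempty.\<close>
  have le_N: "n \<le> N (Suc n)" for n
  proof (induction n)
    case (Suc n)
    have "N (Suc (Suc n)) \<ge> N (Suc n) + 2"
      by (simp add: N_def)
    then show ?case using Suc by linarith
  qed simp
  have "distinguishing_index G \<le> enat (card (edges G))"
    using \<psi> distinguishing_inj_on[OF nbr wr, of \<psi>]
    by (intro distinguishing_index_le[of \<psi>]) (auto simp: bij_betw_def)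
  also have "\<dots> \<le> enat (N (Suc (card (edges G))))" using le_N by simp
  finally have "distinguishing_index G \<le> enat (N k)"
    unfolding k_def by (rule LeastI)
  then obtain \<phi> where \<phi>: "\<phi> \<in> edges G \<rightarrow> {1..N k}" "distinguishing G \<phi>"
    by (rule distinguishing_index_leD)
  \<comment> \<open>An edge has a label in \<open>{1..N k}\<close>, so \<open>N k\<close> is
    positive; for \<open>k < 2\<close> the sum is empty.\<close>
  obtain u v where "(u, v) \<in> parcs G"
    using nbr assms(3) by (metis card.empty ex_in_conv not_numeral_le_zero)
  then have "\<phi> {u, v} \<in> {1..N k}" using \<phi>(1) edgesI by fastforce
  then have "2 \<le> k" by (rule_tac ccontr) (auto simp: N_def)
  then obtain L where "L \<in> edges (lex_product G P2) \<rightarrow> {1..k}" "distinguishing (lex_product G P2) L"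
    using ex_distinguishing_lex_product_P2[OF nbr wr \<phi>] card_codes[of k] unfolding N_def by blast
  then have "distinguishing_index (lex_product G P2) \<le> enat k"
    by (rule distinguishing_index_le)
  then show ?thesis unfolding k_def N_def .
qed

end
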